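(* Let $N\ge1$, $T>0$, let $L\subset\mathbb{R}$ be a lattice and $\mathbb{S}^1\cong\mathbb{R}/L$. Let $$\left\{\frac{d}{dt}X=A_\alpha(t)X\right\}_{\alpha\in\mathbb{S}^1\cong\mathbb{R}/L}$$ be a periodically parameterized periodic linear ODE with $N\times N$ complex coefficient matrix $A_\alpha(t)=A(\alpha,t)$ and with $T$ the period of $A(\alpha,\cdot)$. If the monodromy matrix $X_\alpha(T)$ is locally $C^1$-diagonalizable for all $\alpha\in\mathbb{S}^1$, then this parameterized ODE has trivial Type I.b homotopy class; that is, for every $n\in\{1,\ldots,N\}$ the Type I.b homotopy class of $\eta_n$ in $[\mathbb{R}/L_n,\mathbb{CP}^{N-1}]$ is the class of a constant map.
   Context: Setting: $A:\mathbb{R}\times\mathbb{R}\to\mathrm{Mat}_{N\times N}(\mathbb{C})$, $(\gamma,t)\mapsto A(\gamma,t)$, is continuously differentiable, $L$-periodic in $\gamma$ and $T$-periodic in $t$; for $\alpha=\gamma \bmod L$ one writes $A(\alpha,t)=A(\gamma,t)$. $X_\alpha(t)$ is the fundamental solution, i.e. $\frac{d}{dt}X_\alpha=A(\alpha,t)X_\alpha$, $X_\alpha(0)=\mathrm{Id}_N$; one also writes $X_\gamma=X_{\gamma \bmod L}$. The monodromy matrix is $X_\alpha(T)$ and its eigenvalues are the characteristic multipliers. Local $C^1$-diagonalizability of $\alpha\mapsto X_\alpha(T)$: each $\alpha$ has a neighborhood $W$ with continuously differentiable functions $\lambda_1,\ldots,\lambda_N:W\to\mathbb{C}$ and $\eta_1,\ldots,\eta_N:W\to\mathbb{CP}^{N-1}$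 such that for all $\alpha'\in W$ the tuple $(\lambda_1(\alpha'),\ldots,\lambda_N(\alpha'))$ gives the eigenvalues of $X_{\alpha'}(T)$, $(\eta_1(\alpha'),\ldots,\eta_N(\alpha'))$ are the respective eigenspaces, and $\mathrm{span}_{\mathbb{C}}(\eta_1(\alpha'),\ldots,\eta_N(\alpha'))=\mathbb{C}^N$. Type I.b homotopy class: let $(\lambda_1(\gamma),\ldots,\lambda_N(\gamma))$, $\gamma\in\mathbb{R}$, be a continuously differentiable parameterization of the characteristic multipliers with corresponding continuously differentiably parameterized eigenspaces $\eta_n:\mathbb{R}\to\mathbb{CP}^{N-1}$. Let $L_n\subset L$ be the maximal sublattice such that $\lambda_n$ is $L_n$-periodic; $\lambda_n$ and its associated eigenspace $\eta_n$ are regarded as functions on the torus (here circle) $\mathbb{R}/L_n$. The Type I.b homotopy class associated to $\eta_n$ is the homotopy class of $\eta_n$ in $[\mathbb{R}/L_n,\mathbb{CP}^{N-1}]$, where $[Y,Z]$ denotes the set of (free) homotopy classes of continuous maps $Y\to Z$. *)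

theory Defs
  imports "HOL-Analysis.Analysis"
begin

section \<open>Quotient topologies and homotopy classes\<close>

definition quot_topology :: "'a topology \<Rightarrow> ('a \<Rightarrow> 'b) \<Rightarrow> 'b topology" where
  "quot_topology X q =
     topology (\<lambda>U. U \<subseteq> q ` topspace X \<and> openin X {x \<in> topspace X. q x \<in> U})"

lemma openin_quot_topology:
  "openin (quot_topology X q) U \<longleftrightarrow>
     U \<subseteq> q ` topspace X \<and> openin X {x \<in> topspace X. q x \<in> U}"
proof -
  have "istopology (\<lambda>U. U \<subseteq> q ` topspace X \<and> openin X {x \<in> topspace X. q x \<in> U})"
    unfolding istopology_def
  proof (intro conjI allI impI)
    fix S T
    assume S: "S \<subseteq> q ` topspace X \<and> openin X {x \<in> topspace X. q x \<in> S}"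
      and T: "T \<subseteq> q ` topspace X \<and> openin X {x \<in> topspace X. q x \<in> T}"
    show "S \<inter> T \<subseteq> q ` topspace X" using S by blast
    have "{x \<in> topspace X. q x \<in> S \<inter> T} =
          {x \<in> topspace X. q x \<in> S} \<inter> {x \<in> topspace X. q x \<in> T}" by blast
    then show "openin X {x \<in> topspace X. q x \<in> S \<inter> T}"
      by (simp only:) (rule openin_Int; use S T in blast)
  next
    fix K
    assume K: "\<forall>S\<in>K. S \<subseteq> q ` topspace X \<and> openin X {x \<in> topspace X. q x \<in> S}"
    show "\<Union>K \<subseteq> q ` topspace X" using K by blast
    have "{x \<in> topspace X. q x \<in> \<Union>K} = (\<Union>S\<in>K. {x \<in> topspace X. q x \<in> S})" by blast
    then show "openin X {x \<in> topspace X. q x \<in> \<Union>K}"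
      by (simp only:) (rule openin_Union, use K in blast)
  qed
  then show ?thesis unfolding quot_topology_def by (simp only: topology_inverse')
qed

lemma topspace_quot_topology [simp]: "topspace (quot_topology X q) = q ` topspace X"
proof
  show "topspace (quot_topology X q) \<subseteq> q ` topspace X"
    using openin_topspace[of "quot_topology X q"] unfolding openin_quot_topology by (rule conjunct1)
  have "{x \<in> topspace X. q x \<in> q ` topspace X} = topspace X" by blast
  then have "openin (quot_topology X q) (q ` topspace X)"
    by (simp only: openin_quot_topology) simp
  then show "q ` topspace X \<subseteq> topspace (quot_topology X q)"
    by (rule openin_subset)
qed

lemma quotient_map_quot_topology: "quotient_map X (quot_topology X q) q"
  unfolding quotient_map_def topspace_quot_topology openin_quot_topology by blast

text \<open>The element of \<open>[Y,Z]\<close> represented by \<open>f\<close> (free homotopies).\<close>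

definition homotopy_class :: "'a topology \<Rightarrow> 'b topology \<Rightarrow> ('a \<Rightarrow> 'b) \<Rightarrow> ('a \<Rightarrow> 'b) set" where
  "homotopy_class Y Z f = {g. homotopic_with (\<lambda>_. True) Y Z f g}"


section \<open>Lattices, periods and the circles \<open>\<real>/M\<close>\<close>

definition real_lattice :: "real set \<Rightarrow> bool" where
  "real_lattice L \<longleftrightarrow> (\<exists>l. l \<noteq> 0 \<and> L = range (\<lambda>k::int. of_int k * l))"

definition periodic_wrt :: "real set \<Rightarrow> (real \<Rightarrow> 'a) \<Rightarrow> bool" where
  "periodic_wrt M f \<longleftrightarrow> (\<forall>l\<in>M. \<forall>x. f (x + l) = f x)"

text \<open>Sublattices of \<open>L\<close> are its subgroups; the zero subgroup is included, so that the
  maximal sublattice of periods exists for every \<open>f\<close>.\<close>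

definition sublattice :: "real set \<Rightarrow> real set \<Rightarrow> bool" where
  "sublattice M L \<longleftrightarrow> M \<subseteq> L \<and> 0 \<in> M \<and> (\<forall>x\<in>M. \<forall>y\<in>M. x - y \<in> M)"

definition max_period_sublattice :: "real set \<Rightarrow> (real \<Rightarrow> 'a) \<Rightarrow> real set" where
  "max_period_sublattice L f = (GREATEST M. sublattice M L \<and> periodic_wrt M f)"

lemma max_period_sublattice_eq:
  assumes "real_lattice L"
  shows "max_period_sublattice L f = {l \<in> L. \<forall>x. f (x + l) = f x}" (is "_ = ?P")
  unfolding max_period_sublattice_def
proof (rule Greatest_equality)
  obtain l where L: "L = range (\<lambda>k::int. of_int k * l)"
    using assms by (auto simp: real_lattice_def)
  have zero: "0 \<in> L" unfolding L by (rule range_eqI[of _ _ 0]) simp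
  have diff: "a - b \<in> L" if ab: "a \<in> L" "b \<in> L" for a b
  proof -
    obtain i j :: int where "a = of_int i * l" "b = of_int j * l" using ab L by blast
    then have "a - b = of_int (i - j) * l" by (simp add: algebra_simps)
    then show ?thesis unfolding L by (rule range_eqI)
  qed
  have per: "f (x + (a - b)) = f x"
    if a: "\<forall>x. f (x + a) = f x" and b: "\<forall>x. f (x + b) = f x" for a b x
  proof -
    have "f (x - b + a) = f (x - b)" by (rule a[rule_format])
    also have "\<dots> = f (x - b + b)" by (rule b[rule_format, symmetric])
    finally show ?thesis by (simp only: diff_add_cancel add_diff_eq diff_add_eq)
  qed
  have "sublattice ?P L"
    unfolding sublattice_def
  proof (intro conjI ballI)
    show "?P \<subseteq> L" by blast
    show "0 \<in> ?P" using zero by simp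
    fix a b assume "a \<in> ?P" "b \<in> ?P"
    then show "a - b \<in> ?P" using diff per by blast
  qed
  moreover have "periodic_wrt ?P f"
    unfolding periodic_wrt_def by blast
  ultimately show "sublattice ?P L \<and> periodic_wrt ?P f" ..
next
  fix M assume "sublattice M L \<and> periodic_wrt M f"
  then show "M \<le> ?P" unfolding sublattice_def periodic_wrt_def by blast
qed

definition real_coset :: "real set \<Rightarrow> real \<Rightarrow> real set" where
  "real_coset M x = (\<lambda>l. x + l) ` M"

definition circle_mod :: "real set \<Rightarrow> (real set) topology" where
  "circle_mod M = quot_topology euclideanreal (real_coset M)"

text \<open>An \<open>M\<close>-periodic function on \<open>\<real>\<close>, regarded as a function on \<open>\<real>/M\<close>.\<close>

definition on_circle :: "(real \<Rightarrow> 'a) \<Rightarrow> real set \<Rightarrow> 'a" where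
  "on_circle f c = the_elem (f ` c)"

lemma on_circle_coset:
  assumes "periodic_wrt M f" "M \<noteq> {}"
  shows "on_circle f (real_coset M x) = f x"
proof -
  have "f ` real_coset M x = {f x}"
    using assms unfolding real_coset_def periodic_wrt_def image_image
    by (simp cong: image_cong_simp) blast
  then show ?thesis by (simp add: on_circle_def)
qed


section \<open>Complex projective space\<close>

text \<open>Projective \<open>(CARD('n) - 1)\<close>-space; its points are the complex lines through 0, as sets of
  vectors.\<close>

definition complex_projective_space :: "(complex^'n) set topology" where
  "complex_projective_space = quot_topology (top_of_set (UNIV - {0})) (\<lambda>v. vec.span {v})"

text \<open>The standard affine charts. A line in the \<open>k\<close>-th chart domain is sent to its representative
  with \<open>k\<close>-th coordinate 1, so the target
  \<open>(CARD('n) - 1)\<close>-dimensional space is realised as an affine hyperplane.\<close>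

definition chart_domain :: "'n \<Rightarrow> (complex^'n) set set" where
  "chart_domain k = {l \<in> topspace complex_projective_space. \<exists>v\<in>l. v $ k \<noteq> 0}"

definition affine_chart :: "'n \<Rightarrow> (complex^'n) set \<Rightarrow> complex^'n" where
  "affine_chart k l = (THE v. v \<in> l \<and> v $ k = 1)"

text \<open>To be used for open \<open>W\<close> only: the derivatives are two-sided.\<close>

definition C1_projective_on :: "(real \<Rightarrow> (complex^'n) set) \<Rightarrow> real set \<Rightarrow> bool" where
  "C1_projective_on f W \<longleftrightarrow>
     continuous_map (top_of_set W) complex_projective_space f \<and>
     (\<forall>k. (\<lambda>x. affine_chart k (f x)) C1_differentiable_on {x \<in> W. f x \<in> chart_domain k})"


section \<open>Parameterized periodic linear ODEs\<close>

definition continuously_differentiable ::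
    "('a::real_normed_vector \<Rightarrow> 'b::real_normed_vector) \<Rightarrow> bool" where
  "continuously_differentiable f \<longleftrightarrow>
     (\<exists>f' :: 'a \<Rightarrow> 'a \<Rightarrow>\<^sub>L 'b.
        (\<forall>x. (f has_derivative blinfun_apply (f' x)) (at x)) \<and> continuous_on UNIV f')"

definition fundamental_solution ::
    "(real \<Rightarrow> real \<Rightarrow> complex^'n^'n) \<Rightarrow> (real \<Rightarrow> real \<Rightarrow> complex^'n^'n) \<Rightarrow> bool" where
  "fundamental_solution A X \<longleftrightarrow>
     (\<forall>\<gamma>. X \<gamma> 0 = mat 1 \<and>
          (\<forall>t. ((\<lambda>s. X \<gamma> s) has_vector_derivative A \<gamma> t ** X \<gamma> t) (at t)))"

text \<open>The \<open>\<mu> n\<close> are the eigenvalues of \<open>M\<close> with multiplicity. If \<open>\<mu> n\<close> is a multiple eigenvalue,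
  \<open>\<eta> n\<close> is one line inside its eigenspace.\<close>

definition eigen_decomposition ::
    "complex^'n^'n \<Rightarrow> ('n \<Rightarrow> complex) \<Rightarrow> ('n \<Rightarrow> (complex^'n) set) \<Rightarrow> bool" where
  "eigen_decomposition M \<mu> \<eta> \<longleftrightarrow>
     (\<forall>x. det (mat x - M) = (\<Prod>n\<in>UNIV. x - \<mu> n)) \<and>
     (\<forall>n. \<eta> n \<in> topspace complex_projective_space \<and> (\<forall>v\<in>\<eta> n. M *v v = \<mu> n *s v)) \<and>
     vec.span (\<Union>n. \<eta> n) = UNIV"

definition C1_eigen_parameterization_on ::
    "(real \<Rightarrow> complex^'n^'n) \<Rightarrow> real set \<Rightarrow> ('n \<Rightarrow> real \<Rightarrow> complex) \<Rightarrow>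
     ('n \<Rightarrow> real \<Rightarrow> (complex^'n) set) \<Rightarrow> bool" where
  "C1_eigen_parameterization_on M W \<mu> \<eta> \<longleftrightarrow>
     (\<forall>n. (\<mu> n) C1_differentiable_on W) \<and>
     (\<forall>n. C1_projective_on (\<eta> n) W) \<and>
     (\<forall>\<gamma>\<in>W. eigen_decomposition (M \<gamma>) (\<lambda>n. \<mu> n \<gamma>) (\<lambda>n. \<eta> n \<gamma>))"

text \<open>Local diagonalizability over \<open>\<real>/L\<close> is tested on \<open>\<real>\<close>, since \<open>\<real> \<rightarrow> \<real>/L\<close> is a local
  diffeomorphism.\<close>

definition locally_C1_diagonalizable :: "(real \<Rightarrow> complex^'n^'n) \<Rightarrow> bool" where
  "locally_C1_diagonalizable M \<longleftrightarrow>
     (\<forall>\<gamma>. \<exists>W \<mu> \<eta>. open W \<and> \<gamma> \<in> W \<and> C1_eigen_parameterization_on M W \<mu> \<eta>)"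

definition type_Ib_class ::
    "real set \<Rightarrow> (real \<Rightarrow> complex) \<Rightarrow> (real \<Rightarrow> (complex^'n) set) \<Rightarrow>
     (real set \<Rightarrow> (complex^'n) set) set" where
  "type_Ib_class L \<mu>n \<eta>n =
     homotopy_class (circle_mod (max_period_sublattice L \<mu>n)) complex_projective_space
       (on_circle \<eta>n)"

end

theory Submission
  imports Defs
begin

text \<open>
  The argument is purely topological: \<open>\<real>/L\<^sub>n\<close> is either a line, hence contractible, or a circle, and
  complex projective space is simply connected. For the latter, a loop of lines, pulled back
  to \<open>[0,1]\<close>, lifts through the affine charts to a path of nonzero vectors \<open>v\<close> with
  \<open>v 1 = exp a \<cdot> v 0\<close>. Then \<open>exp (- a t) \<cdot> v t\<close> is a closed lift, and it is contractible in the
  punctured space \<open>\<complex>\<^sup>N - {0}\<close> as soon as \<open>N \<ge> 2\<close>; for \<open>N = 1\<close> projective space is a point.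
\<close>

section \<open>Lifting paths of lines\<close>

lemma span_singleton_smult:
  fixes v :: "complex^'n"
  assumes "c \<noteq> 0"
  shows "vec.span {c *s v} = vec.span {v}"
proof -
  have "k *s v = (k / c) *s (c *s v)" for k
    using assms by (simp add: vector_smult_assoc)
  moreover have "k *s (c *s v) = (k * c) *s v" for k
    by (simp add: vector_smult_assoc)
  ultimately show ?thesis
    unfolding vec.span_singleton by blast
qed

lemma span_singleton_eqE:
  fixes v w :: "complex^'n"
  assumes "vec.span {v} = vec.span {w}" "v \<noteq> 0"
  obtains c where "c \<noteq> 0" "v = c *s w"
proof -
  have "v \<in> vec.span {w}"
    using assms(1) vec.span_base[of v "{v}"] by simp
  then obtain c where "v = c *s w"
    unfolding vec.span_singleton by blast
  with assms(2) show ?thesis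
    by (intro that[of c]) auto
qed

lemma continuous_on_smult:
  fixes f :: "'a::topological_space \<Rightarrow> complex" and g :: "'a \<Rightarrow> complex^'n"
  assumes "continuous_on S f" "continuous_on S g"
  shows "continuous_on S (\<lambda>x. f x *s g x)"
  unfolding vector_scalar_mult_def
  by (intro continuous_intros assms)

section \<open>Affine charts of projective space\<close>

lemma topspace_complex_projective_space:
  "topspace complex_projective_space = (\<lambda>v. vec.span {v}) ` (UNIV - {0})"
  by (simp add: complex_projective_space_def)

lemma quotient_map_complex_projective_space:
  "quotient_map (top_of_set (UNIV - {0})) complex_projective_space (\<lambda>v. vec.span {v})"
  unfolding complex_projective_space_def by (rule quotient_map_quot_topology)

lemma span_in_chart_domain_iff:
  fixes v :: "complex^'n"
  assumes "v \<noteq> 0"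
  shows "vec.span {v} \<in> chart_domain k \<longleftrightarrow> v $ k \<noteq> 0"
proof -
  have "v \<in> vec.span {v}"
    by (simp add: vec.span_base)
  then show ?thesis
    using assms unfolding chart_domain_def topspace_complex_projective_space
    by (auto simp: vec.span_singleton)
qed

lemma affine_chart_span:
  fixes v :: "complex^'n"
  assumes "v $ k \<noteq> 0"
  shows "affine_chart k (vec.span {v}) = inverse (v $ k) *s v"
  unfolding affine_chart_def
proof (rule the_equality)
  show "inverse (v $ k) *s v \<in> vec.span {v} \<and> (inverse (v $ k) *s v) $ k = 1"
    using assms by (auto simp: vec.span_singleton intro: rangeI)
next
  fix w assume "w \<in> vec.span {v} \<and> w $ k = 1"
  then obtain c where "w = c *s v" "w $ k = 1"
    unfolding vec.span_singleton by blast
  then show "w = inverse (v $ k) *s v"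
    using assms by (simp add: field_simps)
qed

lemma chart_domain_vimage:
  fixes k :: "'n::finite"
  shows "{v \<in> topspace (top_of_set (UNIV - {0})). vec.span {v} \<in> chart_domain k} =
    {v :: complex^'n. v $ k \<noteq> 0}"
proof -
  have "v \<noteq> 0" if "v $ k \<noteq> 0" for v :: "complex^'n"
    using that by auto
  then show ?thesis
    using span_in_chart_domain_iff by fastforce
qed

lemma openin_chart_domain: "openin complex_projective_space (chart_domain (k::'n::finite))"
proof -
  have "open {v :: complex^'n. v $ k \<noteq> 0}"
    by (intro open_Collect_neq continuous_intros)
  then have "openin (top_of_set (UNIV - {0})) {v :: complex^'n. v $ k \<noteq> 0}"
    by (rule open_subset[rotated]) auto
  moreover have "chart_domain k \<subseteq> topspace complex_projective_space"
    unfolding chart_domain_def by (rule Collect_restrict)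
  ultimately show ?thesis
    unfolding complex_projective_space_def openin_quot_topology topspace_quot_topology
      chart_domain_vimage
    by (rule conjI[rotated])
qed

text \<open>The span map restricts to a quotient map over the open chart domain. Continuity can
  therefore be tested on vectors, where the chart is division by the nonvanishing
  \<open>k\<close>-th coordinate.\<close>

lemma continuous_map_affine_chart:
  "continuous_map (subtopology complex_projective_space (chart_domain k)) euclidean
     (affine_chart (k::'n::finite))"
proof (rule continuous_compose_quotient_map)
  let ?U = "{v :: complex^'n. v $ k \<noteq> 0}"
  show "quotient_map (subtopology (top_of_set (UNIV - {0})) ?U)
      (subtopology complex_projective_space (chart_domain k)) (\<lambda>v. vec.span {v})"
    by (intro quotient_map_restriction quotient_map_complex_projective_space
        chart_domain_vimage disjI1 openin_chart_domain)
  have "continuous_on ?U (\<lambda>v. inverse (v $ k) *s v)"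
    by (intro continuous_on_smult continuous_intros) auto
  then have "continuous_on ?U (affine_chart k \<circ> (\<lambda>v. vec.span {v}))"
    by (rule continuous_on_eq) (simp add: affine_chart_span)
  moreover have "subtopology (top_of_set (UNIV - {0})) ?U = top_of_set ?U"
    unfolding subtopology_subtopology by (rule arg_cong[where f = top_of_set]) auto
  ultimately show "continuous_map (subtopology (top_of_set (UNIV - {0})) ?U) euclidean
      (affine_chart k \<circ> (\<lambda>v. vec.span {v}))"
    by simp
qed

section \<open>Lifts of paths and loops to nonzero vectors\<close>

text \<open>Liftability is treated as a property of intervals: it passes to the union of two
  adjacent intervals and holds on all short intervals around a point, so \<open>Bolzano\<close>
  gives it on the whole of \<open>{a..b}\<close>.\<close>

lemma projective_path_lift:
  fixes f :: "real \<Rightarrow> (complex^'n) set"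
  assumes f: "continuous_map euclideanreal complex_projective_space f" and "a \<le> b"
  obtains v where "continuous_on {a..b} v"
    "\<And>t. t \<in> {a..b} \<Longrightarrow> v t \<noteq> 0 \<and> vec.span {v t} = f t"
proof -
  define P where "P a b \<longleftrightarrow> (\<exists>v. continuous_on {a..b} v \<and>
    (\<forall>t\<in>{a..b}. v t \<noteq> 0 \<and> vec.span {v t} = f t))" for a b
  have "P a b"
    using \<open>a \<le> b\<close>
  proof (induction rule: Bolzano)
    case (trans a b c)
    obtain v where v: "continuous_on {a..b} v"
        "\<And>t. t \<in> {a..b} \<Longrightarrow> v t \<noteq> 0 \<and> vec.span {v t} = f t"
      using trans(1) unfolding P_def by blast
    obtain w where w: "continuous_on {b..c} w"
        "\<And>t. t \<in> {b..c} \<Longrightarrow> w t \<noteq> 0 \<and> vec.span {w t} = f t"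
      using trans(2) unfolding P_def by blast
    \<comment> \<open>Both lifts span the line \<open>f b\<close> at the common endpoint, so they
      differ there by a nonzero scalar. Rescaling \<open>w\<close> by it makes the pieces meet and
      leaves the lines unchanged.\<close>
    have "vec.span {v b} = vec.span {w b}" "v b \<noteq> 0"
      using v(2)[of b] w(2)[of b] trans by auto
    then obtain d where d: "d \<noteq> 0" "v b = d *s w b"
      by (rule span_singleton_eqE)
    define u where "u t = (if t \<le> b then v t else d *s w t)" for t
    have "continuous_on ({a..b} \<union> {b..c}) u"
      unfolding u_def
      by (intro continuous_on_cases v(1) continuous_on_smult continuous_on_const w(1))
        (use d in auto)
    moreover have "{a..b} \<union> {b..c} = {a..c}"
      using trans by auto
    moreover have "u t \<noteq> 0 \<and> vec.span {u t} = f t" if "t \<in> {a..c}" for t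
      using that v(2)[of t] w(2)[of t] d(1)
      by (cases "t \<le> b") (auto simp: u_def span_singleton_smult)
    ultimately show ?case
      unfolding P_def by auto
  next
    case (local x)
    have fx: "f t \<in> topspace complex_projective_space" for t
      using f by (auto simp: continuous_map_def)
    then obtain v0 where v0: "v0 \<noteq> 0" "f x = vec.span {v0}"
      unfolding topspace_complex_projective_space by blast
    \<comment> \<open>Any nonzero coordinate of \<open>v0\<close> selects a chart around
      \<open>f x\<close>; its domain being open, \<open>f\<close> stays in it near
      \<open>x\<close>.\<close>
    then obtain k where k: "v0 $ k \<noteq> 0"
      by (auto simp: vec_eq_iff)
    define U where "U = {t. f t \<in> chart_domain k}"
    have "open U"
      using openin_continuous_map_preimage[OF f openin_chart_domain[of k]]
      by (simp add: U_def)
    moreover have "x \<in> U"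
      using v0 k by (simp add: U_def span_in_chart_domain_iff)
    ultimately obtain d where d: "d > 0" "ball x d \<subseteq> U"
      using open_contains_ball by blast
    have "P r s" if "r \<le> x" "x \<le> s" "s - r < d" for r s
    proof -
      have sub: "{r..s} \<subseteq> U"
        using d that by (force simp: dist_real_def)
      have "continuous_map (top_of_set U)
          (subtopology complex_projective_space (chart_domain k)) f"
        using f by (auto simp: continuous_map_in_subtopology U_def
            intro: continuous_map_from_subtopology)
      then have "continuous_on U (affine_chart k \<circ> f)"
        using continuous_map_compose[OF _ continuous_map_affine_chart] by fastforce
      then have "continuous_on {r..s} (affine_chart k \<circ> f)"
        using sub by (rule continuous_on_subset)
      \<comment> \<open>Inside one chart the normalized representative with \<open>k\<close>-th
        coordinate 1 is itself a lift.\<close>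
      moreover have "affine_chart k (f t) \<noteq> 0 \<and> vec.span {affine_chart k (f t)} = f t"
        if "t \<in> {r..s}" for t
      proof -
        obtain v where v: "v \<noteq> 0" "f t = vec.span {v}"
          using fx[of t] unfolding topspace_complex_projective_space by blast
        moreover have "v $ k \<noteq> 0"
          using sub that v by (auto simp: U_def span_in_chart_domain_iff)
        ultimately show ?thesis
          by (simp add: affine_chart_span span_singleton_smult)
      qed
      ultimately show ?thesis
        unfolding P_def by (intro exI[of _ "affine_chart k \<circ> f"]) auto
    qed
    with d(1) show ?case
      by blast
  qed
  with that show ?thesis
    unfolding P_def by blast
qed

lemma projective_loop_lift:
  fixes f :: "real \<Rightarrow> (complex^'n) set"
  assumes f: "continuous_map euclideanreal complex_projective_space f" and "f 1 = f 0"
  obtains v where "path v" "path_image v \<subseteq> - {0}" "pathfinish v = pathstart v"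
    "\<And>t. t \<in> {0..1} \<Longrightarrow> vec.span {v t} = f t"
proof -
  obtain v where v: "continuous_on {0..1} v"
      "\<And>t. t \<in> {0..1} \<Longrightarrow> v t \<noteq> 0 \<and> vec.span {v t} = f t"
    using projective_path_lift[OF f zero_le_one] by blast
  have "vec.span {v 1} = vec.span {v 0}" "v 1 \<noteq> 0"
    using v(2)[of 0] v(2)[of 1] assms(2) by auto
  then obtain c where "c \<noteq> 0" and c: "v 1 = c *s v 0"
    by (rule span_singleton_eqE)
  then obtain a where a: "c = exp a"
    by (metis exp_Ln)
  \<comment> \<open>The correcting factor is 1 at \<open>t = 0\<close> and the inverse of
    \<open>c\<close> at \<open>t = 1\<close>, which closes the path. It never vanishes, so the lines
    are kept and zero is avoided.\<close>
  define w where "w t = exp (- a * of_real t) *s v t" for t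
  show ?thesis
  proof
    show "path w"
      unfolding path_def w_def
      by (intro continuous_on_smult v(1) continuous_intros)
    show "path_image w \<subseteq> - {0}"
      using v(2) by (auto simp: path_image_def w_def)
    show "pathfinish w = pathstart w"
      by (simp add: pathfinish_def pathstart_def w_def c a vector_smult_assoc
          flip: exp_add)
    show "vec.span {w t} = f t" if "t \<in> {0..1}" for t
      using v(2)[OF that] by (simp add: w_def span_singleton_smult)
  qed
qed


section \<open>Maps from \<open>\<real>/M\<close> to projective space\<close>

text \<open>The integer multipliers of \<open>l\<close> that land in \<open>M\<close> form a
  subgroup of the integers, which is generated by its least positive element, or by 0 if it has
  none. The generator \<open>p\<close> may thus be 0.\<close>

lemma sublattice_range_generator:
  assumes "sublattice M (range (\<lambda>k::int. of_int k * l))"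
  obtains p where "M = range (\<lambda>k::int. of_int k * p)"
proof -
  define I where "I = {k::int. of_int k * l \<in> M}"
  have M: "M = (\<lambda>k. of_int k * l) ` I"
    using assms by (auto simp: I_def sublattice_def)
  have I0: "0 \<in> I"
    using assms by (simp add: I_def sublattice_def)
  have Idiff: "i - j \<in> I" if "i \<in> I" "j \<in> I" for i j
    using that assms by (auto simp: I_def sublattice_def left_diff_distrib)
  have Iuminus: "- i \<in> I" if "i \<in> I" for i
    using Idiff[OF I0 that] by simp
  have Iadd: "i + j \<in> I" if "i \<in> I" "j \<in> I" for i j
    using Idiff[OF that(1) Iuminus[OF that(2)]] by simp
  obtain d where "I = range (\<lambda>k. k * d)"
  proof (cases "I = {0}")
    case True
    then show ?thesis
      by (intro that[of 0]) auto
  next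
    case False
    then obtain i where "i \<in> I" "i \<noteq> 0"
      using I0 by blast
    \<comment> \<open>Either \<open>i\<close> or its negative is positive, and both lie in
      \<open>I\<close>.\<close>
    then have "\<exists>n. n > 0 \<and> int n \<in> I"
      using Iuminus[of i] by (intro exI[of _ "nat \<bar>i\<bar>"]) (auto simp: abs_if)
    define n where "n = (LEAST n. n > 0 \<and> int n \<in> I)"
    have n: "n > 0" "int n \<in> I"
      using LeastI_ex[OF \<open>\<exists>n. n > 0 \<and> int n \<in> I\<close>] by (simp_all add: n_def)
    have n_le: "n \<le> m" if "m > 0" "int m \<in> I" for m
      unfolding n_def using that by (intro Least_le conjI)
    have nat_mult: "int j * int n \<in> I" for j
      by (induction j) (auto simp: I0 distrib_right intro: Iadd n)
    have mult: "j * int n \<in> I" for j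
    proof (cases "j \<ge> 0")
      case True
      then show ?thesis
        using nat_mult[of "nat j"] by simp
    next
      case False
      then show ?thesis
        using Iuminus[OF nat_mult[of "nat (- j)"]] by simp
    qed
    have "j \<in> range (\<lambda>k. k * int n)" if "j \<in> I" for j
    proof -
      \<comment> \<open>Division with remainder: the remainder stays in \<open>I\<close> and is
        below \<open>n\<close>, so minimality of \<open>n\<close> forces it to be 0.\<close>
      have "j mod int n = j - j div int n * int n"
        by (simp add: minus_div_mult_eq_mod)
      then have "j mod int n \<in> I"
        using Idiff[OF that mult] by simp
      moreover have "0 \<le> j mod int n" "j mod int n < int n"
        using n by simp_all
      ultimately have "j mod int n = 0"
        using n_le[of "nat (j mod int n)"] by (cases "j mod int n = 0") auto
      then show ?thesis
        by (metis dvd_div_mult_self mod_0_imp_dvd rangeI)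
    qed
    with mult show ?thesis
      by (intro that[of "int n"]) auto
  qed
  then have "M = range (\<lambda>k::int. of_int k * (of_int d * l))"
    unfolding M image_image by (simp add: image_image mult.assoc)
  with that show ?thesis .
qed

section \<open>Periodic functions on the quotient\<close>

lemma quotient_map_real_coset: "quotient_map euclideanreal (circle_mod M) (real_coset M)"
  unfolding circle_mod_def by (rule quotient_map_quot_topology)

lemma topspace_circle_mod: "topspace (circle_mod M) = range (real_coset M)"
  by (simp add: circle_mod_def)

text \<open>By the quotient property, continuity is tested after composing with
  \<open>real_coset M\<close>, which gives back \<open>f\<close>. A nonempty \<open>M\<close> makes
  every coset nonempty, so that \<open>the_elem\<close> in \<open>on_circle\<close> picks an actual
  value.\<close>

lemma continuous_map_on_circle:
  assumes "continuous_map euclideanreal Z f" "periodic_wrt M f" "M \<noteq> {}"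
  shows "continuous_map (circle_mod M) Z (on_circle f)"
proof (rule continuous_compose_quotient_map[OF quotient_map_real_coset])
  have "on_circle f \<circ> real_coset M = f"
    using on_circle_coset[OF assms(2,3)] by (auto simp: fun_eq_iff)
  with assms(1) show "continuous_map euclideanreal Z (on_circle f \<circ> real_coset M)"
    by simp
qed

lemma on_circle_compose:
  assumes "periodic_wrt M f" "M \<noteq> {}" "y \<in> topspace (circle_mod M)"
  shows "on_circle (g \<circ> f) y = g (on_circle f y)"
proof -
  obtain x where "y = real_coset M x"
    using assms(3) by (auto simp: topspace_circle_mod)
  moreover have "periodic_wrt M (g \<circ> f)"
    using assms(1) by (simp add: periodic_wrt_def)
  ultimately show ?thesis
    using assms(1,2) by (simp add: on_circle_coset)
qed

section \<open>Null-homotopies\<close>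

text \<open>For a trivial period group the quotient is a copy of the real line, so a contraction of
  the line can be transported to it.\<close>

lemma nullhomotopic_on_circle_zero:
  assumes "continuous_map euclideanreal Z f"
  obtains c where "homotopic_with (\<lambda>_. True) (circle_mod {0}) Z (on_circle f) (\<lambda>_. c)"
proof -
  obtain c where c: "homotopic_with (\<lambda>_. True) euclideanreal Z f (\<lambda>_. c)"
    using nullhomotopic_from_contractible_space[OF assms contractible_space_euclideanreal] .
  \<comment> \<open>Cosets of \<open>{0}\<close> are singletons, and
    \<open>on_circle (\<lambda>x. x)\<close> returns their only point; it identifies the quotient
    with the line.\<close>
  have per: "periodic_wrt {0} (\<lambda>x::real. x)"
    by (simp add: periodic_wrt_def)
  have "continuous_map (circle_mod {0}) euclideanreal (on_circle (\<lambda>x. x))"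
    using continuous_map_on_circle[OF _ per] by simp
  with c have "homotopic_with (\<lambda>_. True) (circle_mod {0}) Z
      (f \<circ> on_circle (\<lambda>x. x)) ((\<lambda>_. c) \<circ> on_circle (\<lambda>x. x))"
    by (rule homotopic_with_compose_continuous_map_right) simp
  moreover have "on_circle f y = f (on_circle (\<lambda>x. x) y)"
    if "y \<in> topspace (circle_mod {0})" for y
    using on_circle_compose[OF per _ that, of f] by (simp add: o_def)
  ultimately show ?thesis
    by (intro that[of c]) (erule homotopic_with_eq; simp)
qed

text \<open>This turns the angle of a point on the unit circle into a parameter in
  \<open>[0,1)\<close>. The integer part of \<open>x\<close> contributes only full turns, and on
  \<open>[0,1)\<close> the angle is read off directly.\<close>

lemma Arg2pi_exp_frac: "Arg2pi (exp (2 * of_real pi * \<i> * of_real x)) / (2 * pi) = frac x"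
proof -
  have "exp (2 * of_real pi * \<i> * of_real x) =
      exp (2 * of_real pi * \<i> * of_real (frac x))"
    unfolding exp_eq
    by (rule exI[of _ "\<lfloor>x\<rfloor>"]) (simp add: frac_def algebra_simps)
  also have "Arg2pi \<dots> = 2 * pi * frac x"
    using frac_lt_1[of x] by (subst Arg2pi_exp) (simp_all add: frac_ge_0)
  finally show ?thesis
    by simp
qed

text \<open>One period of \<open>f\<close> lifts to a loop of nonzero vectors. Regarded as a map on
  the unit circle, it is contracted among nonzero vectors; the contraction is projected to lines and
  pulled back to the quotient along the exponential.\<close>

lemma nullhomotopic_on_circle_projective:
  fixes f :: "real \<Rightarrow> (complex^'n) set"
  assumes f: "continuous_map euclideanreal complex_projective_space f"
    and M: "M = range (\<lambda>k::int. of_int k * p)" and "p \<noteq> 0"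
    and per: "periodic_wrt M f" and card: "CARD('n) \<ge> 2"
  obtains c where
    "homotopic_with (\<lambda>_. True) (circle_mod M) complex_projective_space (on_circle f) (\<lambda>_. c)"
proof -
  have ne: "M \<noteq> {}"
    using M by simp
  have f_add: "f (x + of_int k * p) = f x" for x k
    using per M unfolding periodic_wrt_def by blast
  have "continuous_map euclideanreal euclideanreal ((*) p)"
    by (simp add: continuous_intros)
  then have "continuous_map euclideanreal complex_projective_space (f \<circ> (*) p)"
    using f by (rule continuous_map_compose)
  moreover have "(f \<circ> (*) p) 1 = (f \<circ> (*) p) 0"
    using f_add[of 0 1] by simp
  ultimately obtain v where v: "path v" "path_image v \<subseteq> - {0}" "pathfinish v = pathstart v"
      "\<And>t. t \<in> {0..1} \<Longrightarrow> vec.span {v t} = (f \<circ> (*) p) t"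
    using projective_loop_lift by blast
  \<comment> \<open>\<open>Arg2pi z / (2 * pi)\<close> inverts the map from \<open>t\<close> in
    \<open>[0,1)\<close> to \<open>exp (2 pi i t)\<close>, so \<open>w\<close> is the loop
    \<open>v\<close> as a map on the unit circle.\<close>
  define w where "w = v \<circ> (\<lambda>z. Arg2pi z / (2 * pi))"
  define a where "a = v 0"
  have "a \<in> - {0}"
    using v(2) pathstart_in_path_image[of v] by (auto simp: a_def pathstart_def)
  \<comment> \<open>The real dimension is \<open>2 * CARD('n)\<close>, hence at least 4; a punctured
    Euclidean space is simply connected from dimension 3 on.\<close>
  moreover have "simply_connected (- {0 :: complex^'n})"
    using card by (intro simply_connected_punctured_universe) simp
  ultimately have "homotopic_loops (- {0}) v (linepath a a)"
    using v(1-3) unfolding simply_connected_eq_contractible_loop_any by blast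
  then have "homotopic_with (\<lambda>_. True) (top_of_set (sphere 0 1)) (top_of_set (UNIV - {0}))
      w (linepath a a \<circ> (\<lambda>z. Arg2pi z / (2 * pi)))"
    unfolding w_def Compl_eq_Diff_UNIV[symmetric]
    by (rule homotopic_loops_imp_homotopic_circlemaps)
  then have hom1: "homotopic_with (\<lambda>_. True) (top_of_set (sphere 0 1)) complex_projective_space
      ((\<lambda>v. vec.span {v}) \<circ> w)
      ((\<lambda>v. vec.span {v}) \<circ> (linepath a a \<circ> (\<lambda>z. Arg2pi z / (2 * pi))))"
    by (rule homotopic_with_compose_continuous_map_left)
      (simp_all add: quotient_imp_continuous_map quotient_map_complex_projective_space)
  \<comment> \<open>\<open>e\<close> winds the line once around the unit circle per period
    \<open>p\<close> and so descends to the quotient by \<open>M\<close>.\<close>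
  define e where "e x = exp (2 * of_real pi * \<i> * of_real (x / p))" for x :: real
  have e_per: "periodic_wrt M e"
    unfolding periodic_wrt_def M
  proof (intro ballI allI)
    fix l x assume "l \<in> range (\<lambda>k::int. of_int k * p)"
    then obtain k :: int where "l = of_int k * p" by blast
    then have "(x + l) / p = x / p + of_int k"
      using \<open>p \<noteq> 0\<close> by (simp add: add_divide_distrib)
    then show "e (x + l) = e x"
      unfolding e_def exp_eq by (intro exI[of _ k]) (simp add: algebra_simps)
  qed
  have "continuous_on UNIV e"
    unfolding e_def using \<open>p \<noteq> 0\<close> by (intro continuous_intros) auto
  then have "continuous_map euclideanreal (top_of_set (sphere 0 1)) e"
    by (auto simp: continuous_map_in_subtopology e_def)
  then have "continuous_map (circle_mod M) (top_of_set (sphere 0 1)) (on_circle e)"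
    using e_per ne by (rule continuous_map_on_circle)
  with hom1 have hom2: "homotopic_with (\<lambda>_. True) (circle_mod M) complex_projective_space
      ((\<lambda>v. vec.span {v}) \<circ> w \<circ> on_circle e)
      ((\<lambda>v. vec.span {v}) \<circ> (linepath a a \<circ> (\<lambda>z. Arg2pi z / (2 * pi))) \<circ> on_circle e)"
    by (rule homotopic_with_compose_continuous_map_right) simp
  \<comment> \<open>One end of \<open>hom2\<close> is \<open>on_circle f\<close>:
    \<open>Arg2pi\<close> replaces \<open>x / p\<close> by its fractional part, which moves
    \<open>x\<close> by an integer multiple of \<open>p\<close> and does not change
    \<open>f\<close>.\<close>
  have eq: "on_circle f y = vec.span {w (on_circle e y)}"
    if y_in: "y \<in> topspace (circle_mod M)" for y
  proof -
    obtain x where y: "y = real_coset M x"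
      using y_in unfolding topspace_circle_mod by blast
    have "w (e x) = v (frac (x / p))"
      unfolding w_def e_def o_def Arg2pi_exp_frac ..
    also have "vec.span {\<dots>} = f (p * frac (x / p))"
      using v(4)[of "frac (x / p)"] frac_lt_1[of "x / p"] by (simp add: less_imp_le)
    also have "p * frac (x / p) = x + of_int (- \<lfloor>x / p\<rfloor>) * p"
      using \<open>p \<noteq> 0\<close> by (simp add: frac_def field_simps)
    also have "f \<dots> = f x"
      by (rule f_add)
    finally show ?thesis
      using ne per e_per by (simp add: y on_circle_coset)
  qed
  show ?thesis
  \<comment> \<open>The other end of \<open>hom2\<close> is constant because
    \<open>linepath a a\<close> never leaves \<open>a\<close>.\<close>
  proof (rule that[of "vec.span {a}"], rule homotopic_with_eq[OF hom2])
    show "on_circle f y = ((\<lambda>v. vec.span {v}) \<circ> w \<circ> on_circle e) y"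
      if "y \<in> topspace (circle_mod M)" for y
      using eq[OF that] by simp
  qed (simp_all add: linepath_refl)
qed

text \<open>With a single coordinate, every vector is a multiple of any nonzero one, so each nonzero
  vector spans the whole space.\<close>

lemma topspace_complex_projective_space_point:
  assumes "CARD('n::finite) = 1"
  shows "topspace complex_projective_space = {UNIV :: (complex^'n) set}"
proof -
  obtain k :: 'n where "UNIV = {k}"
    using card_1_singletonE[OF assms] by blast
  then have k: "i = k" for i
    by blast
  have "vec.span {v} = UNIV" if "v \<noteq> 0" for v :: "complex^'n"
  proof -
    have "v $ k \<noteq> 0"
      using that k by (metis vec_eq_iff zero_index)
    then have "w = (w $ k / v $ k) *s v" for w
      using k by (metis nonzero_eq_divide_eq vec_eq_iff vector_smult_component)
    then show ?thesis
      unfolding vec.span_singleton by blast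
  qed
  \<comment> \<open>A nonzero vector must exist for projective space to be inhabited.\<close>
  moreover have "(1 :: complex^'n) \<noteq> 0"
    by simp
  ultimately show ?thesis
    unfolding topspace_complex_projective_space by (auto simp: image_iff)
qed

lemma nullhomotopic_on_circle_sublattice:
  fixes f :: "real \<Rightarrow> (complex^'n) set"
  assumes f: "continuous_map euclideanreal complex_projective_space f"
    and "real_lattice L" "sublattice M L" and per: "periodic_wrt M f"
  obtains c where
    "homotopic_with (\<lambda>_. True) (circle_mod M) complex_projective_space (on_circle f) (\<lambda>_. c)"
proof -
  obtain l where L: "L = range (\<lambda>k::int. of_int k * l)"
    using \<open>real_lattice L\<close> by (auto simp: real_lattice_def)
  obtain p where M: "M = range (\<lambda>k::int. of_int k * p)"
    using sublattice_range_generator \<open>sublattice M L\<close> unfolding L by blast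
  have cont: "continuous_map (circle_mod M) complex_projective_space (on_circle f)"
    using continuous_map_on_circle[OF f per] M by simp
  \<comment> \<open>The quotient is a line if \<open>p = 0\<close> and a circle otherwise. On the
    circle, dimension 1 is separate because the punctured complex plane is not simply connected,
    while projective space is then a point.\<close>
  consider "p = 0" | "p \<noteq> 0" "CARD('n) \<ge> 2" | "CARD('n) = 1"
    by (metis One_nat_def Suc_leI le_neq_implies_less numeral_2_eq_2 zero_less_card_finite)
  then show ?thesis
  proof cases
    case 1
    then have "M = {0}"
      using M by auto
    with that show ?thesis
      using nullhomotopic_on_circle_zero[OF f] by blast
  next
    case 2
    with that show ?thesis
      using nullhomotopic_on_circle_projective[OF f M _ per] by blast
  next
    case 3
    have "on_circle f y = UNIV" if "y \<in> topspace (circle_mod M)" for y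
      using continuous_map_image_subset_topspace[OF cont] that
      unfolding topspace_complex_projective_space_point[OF 3] by blast
    with cont have "homotopic_with (\<lambda>_. True) (circle_mod M) complex_projective_space
        (on_circle f) (\<lambda>_. UNIV)"
      by (intro homotopic_with_equal) auto
    with that show ?thesis .
  qed
qed

section \<open>Homotopy classes and the conclusion\<close>

lemma homotopy_class_eqI:
  assumes "homotopic_with (\<lambda>_. True) Y Z f g"
  shows "homotopy_class Y Z f = homotopy_class Y Z g"
proof -
  have "homotopic_with (\<lambda>_. True) Y Z f h \<longleftrightarrow> homotopic_with (\<lambda>_. True) Y Z g h" for h
    using assms homotopic_with_sym homotopic_with_trans by metis
  then show ?thesis
    by (simp add: homotopy_class_def)
qed

lemma sublattice_max_period_sublattice:
  assumes "real_lattice L"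
  shows "sublattice (max_period_sublattice L f) L"
  unfolding max_period_sublattice_eq[OF assms] sublattice_def
proof (intro conjI ballI)
  obtain l where L: "L = range (\<lambda>k::int. of_int k * l)"
    using assms by (auto simp: real_lattice_def)
  have "0 = of_int 0 * l"
    by simp
  then have "0 \<in> L"
    unfolding L by blast
  then show "0 \<in> {l \<in> L. \<forall>x. f (x + l) = f x}"
    by simp
  fix a b assume ab: "a \<in> {l \<in> L. \<forall>x. f (x + l) = f x}" "b \<in> {l \<in> L. \<forall>x. f (x + l) = f x}"
  then have "a \<in> L" "b \<in> L"
    by blast+
  then obtain i j :: int where "a = of_int i * l" "b = of_int j * l"
    unfolding L by (elim rangeE)
  then have "a - b = of_int (i - j) * l"
    by (simp add: left_diff_distrib)
  then have "a - b \<in> L"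
    unfolding L by blast
  \<comment> \<open>Both shifts are applied at \<open>x - b\<close>: adding \<open>a\<close> gives
    \<open>x + (a - b)\<close>, adding \<open>b\<close> gives \<open>x\<close>.\<close>
  moreover have "f (x + (a - b)) = f x" for x
  proof -
    have "f (x - b + a) = f (x - b)" "f (x - b + b) = f (x - b)"
      using ab by blast+
    then show ?thesis
      by (simp add: algebra_simps)
  qed
  ultimately show "a - b \<in> {l \<in> L. \<forall>x. f (x + l) = f x}"
    by blast
qed blast

text \<open>The periodicity premise on \<open>\<eta> n\<close> expresses that the eigenspace is
  regarded as a function on the quotient by the period lattice of its multiplier.\<close>

theorem lemma5:
  fixes A X :: "real \<Rightarrow> real \<Rightarrow> complex^'n^'n"
    and L :: "real set" and T :: real
  assumes "T > 0"
    and "real_lattice L"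
    and "continuously_differentiable (\<lambda>(\<gamma>, t). A \<gamma> t)"
    and "\<forall>t. periodic_wrt L (\<lambda>\<gamma>. A \<gamma> t)"
    and "\<forall>\<gamma> t. A \<gamma> (t + T) = A \<gamma> t"
    and "fundamental_solution A X"
    and "locally_C1_diagonalizable (\<lambda>\<gamma>. X \<gamma> T)"
  shows "\<forall>(\<mu> :: 'n \<Rightarrow> real \<Rightarrow> complex) (\<eta> :: 'n \<Rightarrow> real \<Rightarrow> (complex^'n) set).
    C1_eigen_parameterization_on (\<lambda>\<gamma>. X \<gamma> T) UNIV \<mu> \<eta> \<longrightarrow>
    (\<forall>n. periodic_wrt (max_period_sublattice L (\<mu> n)) (\<eta> n) \<longrightarrow>
      (\<exists>c \<in> topspace complex_projective_space.
        type_Ib_class L (\<mu> n) (\<eta> n) =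
        homotopy_class (circle_mod (max_period_sublattice L (\<mu> n))) complex_projective_space
          (\<lambda>_. c)))"
proof (intro allI impI)
  fix \<mu> :: "'n \<Rightarrow> real \<Rightarrow> complex" and \<eta> :: "'n \<Rightarrow> real \<Rightarrow> (complex^'n) set" and n
  let ?M = "max_period_sublattice L (\<mu> n)"
  assume C1: "C1_eigen_parameterization_on (\<lambda>\<gamma>. X \<gamma> T) UNIV \<mu> \<eta>"
    and per: "periodic_wrt ?M (\<eta> n)"
  have cont: "continuous_map euclideanreal complex_projective_space (\<eta> n)"
    using C1 by (simp add: C1_eigen_parameterization_on_def C1_projective_on_def)
  have "sublattice ?M L"
    using assms(2) by (rule sublattice_max_period_sublattice)
  then obtain c where c: "homotopic_with (\<lambda>_. True) (circle_mod ?M) complex_projective_space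
      (on_circle (\<eta> n)) (\<lambda>_. c)"
    using nullhomotopic_on_circle_sublattice[OF cont assms(2) _ per] by blast
  \<comment> \<open>The quotient has a point, so continuity of the constant map at the end of the
    homotopy puts \<open>c\<close> into projective space.\<close>
  have "real_coset ?M 0 \<in> topspace (circle_mod ?M)"
    by (simp add: topspace_circle_mod)
  then have "c \<in> topspace complex_projective_space"
    using homotopic_with_imp_continuous_maps[OF c] by (auto simp: continuous_map_def)
  with homotopy_class_eqI[OF c]
  show "\<exists>c\<in>topspace complex_projective_space. type_Ib_class L (\<mu> n) (\<eta> n) =
      homotopy_class (circle_mod ?M) complex_projective_space (\<lambda>_. c)"
    unfolding type_Ib_class_def by blast
qed

end
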